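(* Let $k\ge 3$ and let $G$ be a $k$-graph with vertex set $\{1,\dots,n\}$, vertex degrees $d_1,\dots,d_n$ (all positive) and signless Laplacian tensor $\mathcal Q$. Suppose that $G$ has $s$ components $G_r=(V_r,E_r)$, $r=1,\dots,s$. Then for each $j=1,\dots,n$, $d_j$ is a strict H$^+$-eigenvalue of $\mathcal Q$ with an H-eigenvector $\mathbf e^{(j)}$. Let $\nu_1=\rho(\mathcal Q)$. If $\nu_1=\rho(\mathcal Q(G_r))$ for all $r=1,\dots,s$, then $\nu_1$ is the unique H$^{++}$-eigenvalue of $\mathcal Q$. Otherwise, $\mathcal Q$ has no H$^{++}$-eigenvalue, and for each $r=1,\dots,s$, $\rho(\mathcal Q(G_r))$ is a strict H$^+$-eigenvalue of $\mathcal Q$.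
   Context: A $k$-graph $G=(V,E)$ consists of a vertex set $V=\{1,\dots,n\}$ and a set $E$ of distinct $k$-element subsets of $V$ (edges). Standing assumption: every vertex lies in at least one edge. The degree $d_i$ of vertex $i$ is the number of edges containing $i$. Two vertices are adjacent if they lie in a common edge; two vertices are connected if they are joined by a finite chain of successively adjacent vertices; $G$ is connected if any two of its vertices are connected. The components of $G$ are the $k$-graphs $G_r=(V_r,E_r)$ where $V_1,\dots,V_s$ are the equivalence classes of the relation of being connected and $E_r$ is the set of edges contained in $V_r$. The adjacency tensor $\mathcal A=(a_{i_1\cdots i_k})$ of $G$ is the $k$th order $n$-dimensional symmetric tensor with $a_{i_1\cdots i_k}=\frac1{(k-1)!}$ if $\{i_1,\dots,i_k\}\in E$ (in particular the indices are then distinct), and $0$ otherwise. The degree tensor $\mathcal D$ is the $k$th order $n$-dimensional diagonal tensor with $i$th diagonal entry $d_i$. The signless Laplacian tensor is $\mathcal Q=\mathcal Q(G)=\mathcal D+\mathcal A$; $\mathcal Q(G_r)$ is the signless Laplacian tensor of $G_r$, a tensor of dimension $|V_r|$. For a real $k$th order $n$-dimensional tensor $\mathcal T=(t_{i_1\cdots i_k})$ and a vector $x\in\mathbb C^n$, $\mathcal Tx^{k-1}$ is the vector with $i$th component $\sum_{i_2,\dots,i_k=1}^n t_{ii_2\cdots i_k}x_{i_2}\cdots x_{i_k}$, and $x^{[k-1]}$ is the vector with components $x_i^{k-1}$. A number $\lambda\in\mathbb C$ is an eigenvalue of $\mathcal T$ with eigenvector $x$ if $x\in\mathbb C^n$,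 $x\neq 0$ and $\mathcal Tx^{k-1}=\lambda x^{[k-1]}$. The spectral radius $\rho(\mathcal T)$ is the largest modulus of the eigenvalues of $\mathcal T$. If $x$ is real, then $\lambda$ is real and is called an H-eigenvalue with H-eigenvector $x$. An H-eigenvalue is an H$^+$-eigenvalue if it has an H-eigenvector with all components nonnegative, an H$^{++}$-eigenvalue if it has an H-eigenvector with all components positive, and a strict H$^+$-eigenvalue if it is an H$^+$-eigenvalue but not an H$^{++}$-eigenvalue. $\mathbf e^{(j)}$ is the $j$th standard unit vector of $\mathbb R^n$. *)

theory Defs
  imports Complex_Main
begin

section \<open>Tensors and their eigenvalues\<close>

text \<open>
  A tensor of order \<open>k\<close> and dimension \<open>card I\<close> is given by its entries \<open>T [i\<^sub>1, \<dots>, i\<^sub>k]\<close> with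
  indices from a finite set \<open>I\<close>. Keeping \<open>I\<close> arbitrary rather than \<open>{1..n}\<close> lets the
  components of a hypergraph keep their vertex names. Vectors are functions of which only
  the values on \<open>I\<close> matter.
\<close>

type_synonym 'a tensor = "'a list \<Rightarrow> real"

definition tensor_apply :: "nat \<Rightarrow> 'a set \<Rightarrow> 'a tensor \<Rightarrow> ('a \<Rightarrow> complex) \<Rightarrow> 'a \<Rightarrow> complex" where
  "tensor_apply k I T x i =
     (\<Sum>js | length js = k - 1 \<and> set js \<subseteq> I. complex_of_real (T (i # js)) * (\<Prod>j\<leftarrow>js. x j))"

definition tensor_eigenpair ::
  "nat \<Rightarrow> 'a set \<Rightarrow> 'a tensor \<Rightarrow> complex \<Rightarrow> ('a \<Rightarrow> complex) \<Rightarrow> bool" where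
  "tensor_eigenpair k I T l x \<longleftrightarrow>
     (\<exists>i\<in>I. x i \<noteq> 0) \<and> (\<forall>i\<in>I. tensor_apply k I T x i = l * x i ^ (k - 1))"

definition tensor_eigenvalue :: "nat \<Rightarrow> 'a set \<Rightarrow> 'a tensor \<Rightarrow> complex \<Rightarrow> bool" where
  "tensor_eigenvalue k I T l \<longleftrightarrow> (\<exists>x. tensor_eigenpair k I T l x)"

definition tensor_spectral_radius :: "nat \<Rightarrow> 'a set \<Rightarrow> 'a tensor \<Rightarrow> real" where
  "tensor_spectral_radius k I T = (GREATEST r. \<exists>l. tensor_eigenvalue k I T l \<and> r = cmod l)"

definition H_eigenpair :: "nat \<Rightarrow> 'a set \<Rightarrow> 'a tensor \<Rightarrow> real \<Rightarrow> ('a \<Rightarrow> real) \<Rightarrow> bool" where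
  "H_eigenpair k I T l x \<longleftrightarrow>
     tensor_eigenpair k I T (complex_of_real l) (\<lambda>i. complex_of_real (x i))"

definition Hp_eigenvalue :: "nat \<Rightarrow> 'a set \<Rightarrow> 'a tensor \<Rightarrow> real \<Rightarrow> bool" where
  "Hp_eigenvalue k I T l \<longleftrightarrow> (\<exists>x. H_eigenpair k I T l x \<and> (\<forall>i\<in>I. 0 \<le> x i))"

definition Hpp_eigenvalue :: "nat \<Rightarrow> 'a set \<Rightarrow> 'a tensor \<Rightarrow> real \<Rightarrow> bool" where
  "Hpp_eigenvalue k I T l \<longleftrightarrow> (\<exists>x. H_eigenpair k I T l x \<and> (\<forall>i\<in>I. 0 < x i))"

definition strict_Hp_eigenvalue :: "nat \<Rightarrow> 'a set \<Rightarrow> 'a tensor \<Rightarrow> real \<Rightarrow> bool" where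
  "strict_Hp_eigenvalue k I T l \<longleftrightarrow> Hp_eigenvalue k I T l \<and> \<not> Hpp_eigenvalue k I T l"

definition std_unit_vector :: "'a \<Rightarrow> 'a \<Rightarrow> real" where
  "std_unit_vector j = (\<lambda>i. if i = j then 1 else 0)"

section \<open>Uniform hypergraphs\<close>

text \<open>The standing assumption that every vertex lies in an edge is part of the definition.\<close>

definition kgraph :: "nat \<Rightarrow> 'a set \<Rightarrow> 'a set set \<Rightarrow> bool" where
  "kgraph k V E \<longleftrightarrow>
     finite V \<and> (\<forall>e\<in>E. e \<subseteq> V \<and> card e = k) \<and> (\<forall>v\<in>V. \<exists>e\<in>E. v \<in> e)"

definition vertex_degree :: "'a set set \<Rightarrow> 'a \<Rightarrow> nat" where
  "vertex_degree E i = card {e \<in> E. i \<in> e}"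

definition kgraph_adjacent :: "'a set set \<Rightarrow> 'a \<Rightarrow> 'a \<Rightarrow> bool" where
  "kgraph_adjacent E u v \<longleftrightarrow> (\<exists>e\<in>E. u \<in> e \<and> v \<in> e)"

definition kgraph_connected_rel :: "'a set \<Rightarrow> 'a set set \<Rightarrow> ('a \<times> 'a) set" where
  "kgraph_connected_rel V E = {(u, v) \<in> V \<times> V. (kgraph_adjacent E)\<^sup>*\<^sup>* u v}"

definition kgraph_components :: "'a set \<Rightarrow> 'a set set \<Rightarrow> ('a set \<times> 'a set set) set" where
  "kgraph_components V E =
     (\<lambda>W. (W, {e \<in> E. e \<subseteq> W})) ` (V // kgraph_connected_rel V E)"

text \<open>
  The entries below are meant for index lists of length \<open>k\<close>. Since edges have exactly
  \<open>k\<close> elements, \<open>set js \<in> E\<close> then forces the indices to be distinct.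
\<close>

definition adjacency_tensor :: "nat \<Rightarrow> 'a set set \<Rightarrow> 'a tensor" where
  "adjacency_tensor k E js = (if set js \<in> E then 1 / fact (k - 1) else 0)"

definition degree_tensor :: "nat \<Rightarrow> 'a set set \<Rightarrow> 'a tensor" where
  "degree_tensor k E js =
     (if js = replicate k (hd js) then real (vertex_degree E (hd js)) else 0)"

definition signless_laplacian :: "nat \<Rightarrow> 'a set set \<Rightarrow> 'a tensor" where
  "signless_laplacian k E js = degree_tensor k E js + adjacency_tensor k E js"

end

theory Submission
  imports Defs "HOL-Analysis.Function_Topology" "HOL-Combinatorics.Multiset_Permutations"
begin

text \<open>
  Scaling a positive eigenvector until it dominates any other one shows that its eigenvalue is the
  spectral radius. On a connected \<open>k\<close>-graph a positive eigenvector is found variationally: maximise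
  \<open>\<Sum>\<^sub>i d\<^sub>i x\<^sub>i\<^sup>k + k \<Sum>\<^sub>e \<Prod>\<^sub>j\<^sub>\<in>\<^sub>e x\<^sub>j\<close> over nonnegative \<open>x\<close> with \<open>\<Sum>\<^sub>i x\<^sub>i\<^sup>k = 1\<close>; a perturbation shows that
  the maximiser has full support, and stationarity is the eigenvalue equation. Since edges do
  not leave components, positive eigenvectors of \<open>\<Q>\<close> restrict to the components, those of
  the components glue when their eigenvalues agree, and otherwise they extend by zero.
\<close>

section \<open>The signless Laplacian tensor as a sum over edges\<close>

text \<open>The \<open>i\<close>-th component of \<open>\<Q> x^(k-1)\<close> with the sum over index
  tuples collapsed to a sum over edges. The value type is left general so that real and complex
  vectors share the same formula.\<close>

definition lap_form :: "nat \<Rightarrow> 'a set set \<Rightarrow> ('a \<Rightarrow> 'b::comm_semiring_1) \<Rightarrow> 'a \<Rightarrow> 'b" where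
  "lap_form k E x i = of_nat (vertex_degree E i) * x i ^ (k - 1) + (\<Sum>e | e \<in> E \<and> i \<in> e. \<Prod>j\<in>e - {i}. x j)"

text \<open>An index list as long as the edge it spans has no repetitions, so its tail is an
  enumeration of the remaining vertices of the edge.\<close>

lemma set_Cons_eq_edge_iff:
  assumes "finite e" "card e = Suc m" "i \<in> e"
  shows "length js = m \<and> set (i # js) = e \<longleftrightarrow> js \<in> permutations_of_set (e - {i})"
proof
  assume *: "length js = m \<and> set (i # js) = e"
  then have "card (set (i # js)) = length (i # js)" using assms by simp
  then have "distinct (i # js)" by (rule card_distinct)
  with * show "js \<in> permutations_of_set (e - {i})"
    by (auto simp: permutations_of_set_def)
next
  assume "js \<in> permutations_of_set (e - {i})"
  then have "set js = e - {i}" "distinct js" by (auto simp: permutations_of_set_def)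
  then show "length js = m \<and> set (i # js) = e"
    using assms by (auto simp: distinct_card[symmetric])
qed

text \<open>Index lists with a nonzero entry are grouped by the edge they span. Each edge through
  \<open>i\<close> receives \<open>(k-1)!\<close> lists with the same product, which cancels the
  factor \<open>1 / fact (k - 1)\<close>.\<close>

lemma tensor_apply_adjacency:
  assumes G: "kgraph k V E" and k: "1 \<le> k" and i: "i \<in> V"
  shows "tensor_apply k V (adjacency_tensor k E) x i = (\<Sum>e | e \<in> E \<and> i \<in> e. \<Prod>j\<in>e - {i}. x j)"
proof -
  let ?L = "{js. length js = k - 1 \<and> set js \<subseteq> V}"
  let ?I = "{e. e \<in> E \<and> i \<in> e}"
  have fin: "finite V" and edge: "\<And>e. e \<in> E \<Longrightarrow> e \<subseteq> V \<and> card e = k \<and> finite e"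
    using G by (auto simp: kgraph_def intro: finite_subset)
  have "finite E" using edge fin by (intro finite_subset[of E "Pow V"]) auto
  then have finI: "finite ?I" by simp
  have finL: "finite ?L" using finite_lists_length_eq[OF fin, of "k - 1"] by (simp add: conj_commute)
  have finL': "finite {js \<in> ?L. set (i # js) \<in> ?I}" using finL by (rule rev_finite_subset) blast
  have perm: "{js \<in> ?L. set (i # js) = e} = permutations_of_set (e - {i})" if "e \<in> ?I" for e
  proof -
    have "length js = k - 1 \<and> set (i # js) = e \<longleftrightarrow> js \<in> permutations_of_set (e - {i})" for js
      using that edge[of e] k by (intro set_Cons_eq_edge_iff) auto
    moreover have "set js \<subseteq> V" if "set (i # js) = e" for js
      using that \<open>e \<in> ?I\<close> edge[of e] by auto
    ultimately show ?thesis by blast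
  qed
  have "tensor_apply k V (adjacency_tensor k E) x i =
      (\<Sum>js\<in>?L. if set (i # js) \<in> ?I then 1 / fact (k - 1) * (\<Prod>j\<leftarrow>js. x j) else 0)"
    unfolding tensor_apply_def adjacency_tensor_def by (intro sum.cong) auto
  also have "\<dots> = (\<Sum>js\<in>{js\<in>?L. set (i # js) \<in> ?I}. 1 / fact (k - 1) * (\<Prod>j\<leftarrow>js. x j))"
    using finL by (simp only: sum.inter_filter)
  also have "\<dots> = (\<Sum>e\<in>?I. \<Sum>js\<in>{js\<in>{js\<in>?L. set (i # js) \<in> ?I}. set (i # js) = e}. 1 / fact (k - 1) * (\<Prod>j\<leftarrow>js. x j))"
    by (rule sum.group[OF finL' finI, symmetric]) (rule image_subsetI, simp)
  also have "\<dots> = (\<Sum>e\<in>?I. \<Prod>j\<in>e - {i}. x j)"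
  proof (rule sum.cong)
    fix e assume e: "e \<in> ?I"
    have "{js\<in>{js\<in>?L. set (i # js) \<in> ?I}. set (i # js) = e} = permutations_of_set (e - {i})"
      using e perm[OF e] by auto
    moreover have "(\<Prod>j\<leftarrow>js. x j) = (\<Prod>j\<in>e - {i}. x j)" if "js \<in> permutations_of_set (e - {i})" for js
      using prod.distinct_set_conv_list[of js x] permutations_of_setD[OF that] by simp
    moreover have "card (permutations_of_set (e - {i})) = fact (k - 1)"
      using e edge[of e] by (simp add: card_permutations_of_set)
    ultimately show "(\<Sum>js\<in>{js\<in>{js\<in>?L. set (i # js) \<in> ?I}. set (i # js) = e}. 1 / fact (k - 1) * (\<Prod>j\<leftarrow>js. x j))
        = (\<Prod>j\<in>e - {i}. x j)"
      by simp
  qed simp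
  finally show ?thesis .
qed

lemma tensor_apply_degree:
  assumes "finite V" "1 \<le> k" "i \<in> V"
  shows "tensor_apply k V (degree_tensor k E) x i = of_nat (vertex_degree E i) * x i ^ (k - 1)"
proof -
  let ?L = "{js. length js = k - 1 \<and> set js \<subseteq> V}"
  have finL: "finite ?L" using finite_lists_length_eq[OF assms(1), of "k - 1"] by (simp add: conj_commute)
  have "replicate k i = i # replicate (k - 1) i" using assms(2) by (cases k) auto
  then have "tensor_apply k V (degree_tensor k E) x i =
      (\<Sum>js\<in>?L. if js = replicate (k - 1) i then of_nat (vertex_degree E i) * (\<Prod>j\<leftarrow>js. x j) else 0)"
    unfolding tensor_apply_def degree_tensor_def by (intro sum.cong) auto
  also have "\<dots> = of_nat (vertex_degree E i) * x i ^ (k - 1)"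
    using finL assms by (simp add: prod_list_replicate set_replicate_conv_if)
  finally show ?thesis .
qed

lemma tensor_apply_signless_laplacian:
  assumes "kgraph k V E" "1 \<le> k" "i \<in> V"
  shows "tensor_apply k V (signless_laplacian k E) x i = lap_form k E x i"
proof -
  have "tensor_apply k V (signless_laplacian k E) x i =
      tensor_apply k V (degree_tensor k E) x i + tensor_apply k V (adjacency_tensor k E) x i"
    by (simp add: tensor_apply_def signless_laplacian_def distrib_right sum.distrib)
  then show ?thesis
    using assms tensor_apply_adjacency[OF assms] by (simp add: tensor_apply_degree lap_form_def kgraph_def)
qed

lemma of_real_lap_form:
  "lap_form k E (\<lambda>j. of_real (x j)) i = (of_real (lap_form k E x i) :: complex)"
  by (simp add: lap_form_def)

text \<open>The embedding of the reals is injective and commutes with \<open>lap_form\<close>, so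
  from here on H-eigenpairs are handled entirely over the reals.\<close>

lemma H_eigenpair_signless_laplacian_iff:
  assumes "kgraph k V E" "1 \<le> k"
  shows "H_eigenpair k V (signless_laplacian k E) l x \<longleftrightarrow>
    (\<exists>i\<in>V. x i \<noteq> 0) \<and> (\<forall>i\<in>V. lap_form k E x i = l * x i ^ (k - 1))"
proof -
  have "tensor_apply k V (signless_laplacian k E) (\<lambda>j. complex_of_real (x j)) i = complex_of_real l * complex_of_real (x i) ^ (k - 1)
      \<longleftrightarrow> lap_form k E x i = l * x i ^ (k - 1)" if "i \<in> V" for i
    unfolding tensor_apply_signless_laplacian[OF assms that] of_real_lap_form
    by (metis of_real_eq_iff of_real_mult of_real_power)
  then show ?thesis by (simp add: H_eigenpair_def tensor_eigenpair_def)
qed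

section \<open>A positive eigenvector determines the spectral radius\<close>

lemma lap_form_mono:
  fixes x y :: "'a \<Rightarrow> real"
  assumes "\<And>j. j \<in> \<Union>E \<union> {i} \<Longrightarrow> 0 \<le> x j \<and> x j \<le> y j"
  shows "lap_form k E x i \<le> lap_form k E y i"
  unfolding lap_form_def using assms
  by (intro add_mono mult_left_mono power_mono sum_mono prod_mono) auto

lemma norm_lap_form_le:
  fixes x :: "'a \<Rightarrow> complex"
  shows "cmod (lap_form k E x i) \<le> lap_form k E (\<lambda>j. cmod (x j)) i"
proof -
  have "cmod (\<Sum>e | e \<in> E \<and> i \<in> e. \<Prod>j\<in>e - {i}. x j) \<le> (\<Sum>e | e \<in> E \<and> i \<in> e. \<Prod>j\<in>e - {i}. cmod (x j))"
    by (rule sum_norm_le) (simp add: prod_norm)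
  then show ?thesis
    unfolding lap_form_def by (intro norm_triangle_le) (simp add: norm_mult norm_power)
qed

lemma lap_form_scale:
  fixes x :: "'a \<Rightarrow> 'b :: comm_semiring_1"
  assumes "kgraph k V E"
  shows "lap_form k E (\<lambda>j. c * x j) i = c ^ (k - 1) * lap_form k E x i"
proof -
  have "(\<Prod>j\<in>e - {i}. c * x j) = c ^ (k - 1) * (\<Prod>j\<in>e - {i}. x j)" if "e \<in> E" "i \<in> e" for e
    using that assms by (auto simp: prod.distrib kgraph_def)
  then show ?thesis
    unfolding lap_form_def by (simp add: power_mult_distrib algebra_simps sum_distrib_left)
qed

text \<open>Compare an arbitrary eigenvector \<open>y\<close> with the positive one at an index maximising \<open>\<bar>y i\<bar> / x i\<close>.\<close>

lemma eigenvalue_le_of_positive_eigenvector: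
  assumes G: "kgraph k V E" and k: "1 \<le> k"
    and x: "H_eigenpair k V (signless_laplacian k E) l x" "\<And>i. i \<in> V \<Longrightarrow> 0 < x i"
    and m: "tensor_eigenvalue k V (signless_laplacian k E) m"
  shows "cmod m \<le> l"
proof -
  obtain y where y0: "\<exists>i\<in>V. y i \<noteq> 0" and y: "\<And>i. i \<in> V \<Longrightarrow> lap_form k E y i = m * y i ^ (k - 1)"
    using m tensor_apply_signless_laplacian[OF G k]
    by (auto simp: tensor_eigenvalue_def tensor_eigenpair_def)
  have fin: "finite V" and EV: "\<Union>E \<subseteq> V" using G by (auto simp: kgraph_def)
  let ?q = "\<lambda>i. cmod (y i) / x i"
  define t where "t = Max (?q ` V)"
  have "t \<in> ?q ` V" unfolding t_def using fin y0 by (intro Max_in) auto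
  then obtain i where i: "i \<in> V" "t = ?q i" by auto
  have le: "cmod (y j) \<le> t * x j" if "j \<in> V" for j
  proof -
    have "?q j \<le> t" unfolding t_def using fin that by simp
    then show ?thesis using x(2)[OF that] by (simp add: field_simps)
  qed
  obtain j where j: "j \<in> V" "y j \<noteq> 0" using y0 by auto
  have "0 < cmod (y j)" using j by simp
  then have "0 < t * x j" using le[OF j(1)] by linarith
  then have t: "0 < t" using x(2)[OF j(1)] by (simp add: zero_less_mult_iff)
  have yi: "cmod (y i) = t * x i" using i x(2)[OF i(1)] by simp
  \<comment> \<open>The vector \<open>t * x\<close> dominates \<open>cmod (y j)\<close> for all
    \<open>j\<close> in \<open>V\<close> and touches it at \<open>i\<close>. Monotonicity and
    homogeneity therefore compare \<open>cmod m\<close> with \<open>l\<close> at this index, where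
    the common factor is positive.\<close>
  have "cmod m * (t * x i) ^ (k - 1) = cmod (lap_form k E y i)"
    using y[OF i(1)] yi by (simp add: norm_mult norm_power)
  also have "\<dots> \<le> lap_form k E (\<lambda>j. cmod (y j)) i" by (rule norm_lap_form_le)
  also have "\<dots> \<le> lap_form k E (\<lambda>j. t * x j) i"
    using le i EV by (intro lap_form_mono) auto
  also have "\<dots> = t ^ (k - 1) * lap_form k E x i" by (rule lap_form_scale[OF G])
  also have "\<dots> = l * (t * x i) ^ (k - 1)"
    using x(1) i(1) by (simp add: H_eigenpair_signless_laplacian_iff[OF G k] power_mult_distrib)
  finally show ?thesis using t x(2)[OF i(1)] by simp
qed

text \<open>The comparison bounds all moduli by \<open>l\<close>, and \<open>l\<close> attains the
  bound, so the \<open>GREATEST\<close> in the definition exists and equals \<open>l\<close>. In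
  particular at most one H++-eigenvalue is possible.\<close>

lemma Hpp_eigenvalue_eq_spectral_radius:
  assumes G: "kgraph k V E" and k: "1 \<le> k" and V: "V \<noteq> {}"
    and l: "Hpp_eigenvalue k V (signless_laplacian k E) l"
  shows "tensor_spectral_radius k V (signless_laplacian k E) = l"
proof -
  obtain x where x: "H_eigenpair k V (signless_laplacian k E) l x" "\<And>i. i \<in> V \<Longrightarrow> 0 < x i"
    using l by (auto simp: Hpp_eigenvalue_def)
  have ev: "tensor_eigenvalue k V (signless_laplacian k E) (complex_of_real l)"
    using x(1) by (auto simp: H_eigenpair_def tensor_eigenvalue_def)
  have le: "cmod m \<le> l" if "tensor_eigenvalue k V (signless_laplacian k E) m" for m
    using eigenvalue_le_of_positive_eigenvector[OF G k x that] by blast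
  \<comment> \<open>Comparing \<open>l\<close> with itself gives \<open>cmod l \<le> l\<close>, so
    \<open>l\<close> is its own modulus.\<close>
  have "0 \<le> l" using le[OF ev] by simp
  then show ?thesis
    unfolding tensor_spectral_radius_def using ev le
    by (intro Greatest_equality) (auto intro!: exI[of _ "complex_of_real l"])
qed

section \<open>Existence of a positive eigenvector on a connected \<open>k\<close>-graph\<close>

text \<open>This is the homogeneous form \<open>\<Q> x^k\<close>. Each edge is counted once for each
  of its \<open>k\<close> vertices, hence the factor \<open>k\<close>; the partial derivative in
  \<open>x i\<close> is \<open>k\<close> times \<open>lap_form\<close>.\<close>

definition lap_energy :: "nat \<Rightarrow> 'a set \<Rightarrow> 'a set set \<Rightarrow> ('a \<Rightarrow> real) \<Rightarrow> real" where
  "lap_energy k V E x =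
     (\<Sum>i\<in>V. real (vertex_degree E i) * x i ^ k) + real k * (\<Sum>e\<in>E. \<Prod>j\<in>e. x j)"

lemma kgraph_finite_edges: "kgraph k V E \<Longrightarrow> finite E"
  by (rule finite_subset[of E "Pow V"]) (auto simp: kgraph_def)

lemma lap_energy_scale:
  assumes "kgraph k V E"
  shows "lap_energy k V E (\<lambda>j. c * x j) = c ^ k * lap_energy k V E x"
proof -
  have "(\<Prod>j\<in>e. c * x j) = c ^ k * (\<Prod>j\<in>e. x j)" if "e \<in> E" for e
    using that assms by (auto simp: prod.distrib kgraph_def)
  then show ?thesis
    unfolding lap_energy_def by (simp add: power_mult_distrib algebra_simps sum_distrib_left)
qed

lemma lap_energy_cong:
  assumes "kgraph k V E" "\<And>i. i \<in> V \<Longrightarrow> x i = y i"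
  shows "lap_energy k V E x = lap_energy k V E y"
proof -
  have "(\<Prod>j\<in>e. x j) = (\<Prod>j\<in>e. y j)" if "e \<in> E" for e
    using that assms by (intro prod.cong) (auto simp: kgraph_def)
  then show ?thesis using assms(2) by (simp add: lap_energy_def)
qed

text \<open>Tychonoff in the product topology of the function space. Pinning the coordinates outside
  \<open>V\<close> to \<open>0\<close> makes every factor compact.\<close>

lemma compact_unit_box:
  "compact {x :: 'a \<Rightarrow> real. (\<forall>i\<in>V. x i \<in> {0..1}) \<and> (\<forall>i. i \<notin> V \<longrightarrow> x i = 0)}"
proof -
  have "{x :: 'a \<Rightarrow> real. (\<forall>i\<in>V. x i \<in> {0..1}) \<and> (\<forall>i. i \<notin> V \<longrightarrow> x i = 0)} =
      PiE UNIV (\<lambda>i. if i \<in> V then {0..1} else {0})"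
    by (auto simp: PiE_def Pi_def split: if_splits)
  moreover have "compactin (product_topology (\<lambda>i. euclidean) UNIV)
      (PiE UNIV (\<lambda>i::'a. if i \<in> V then {0..1} else {0::real}))"
    by (subst compactin_PiE) auto
  ultimately show ?thesis by (simp add: euclidean_product_topology)
qed

text \<open>The maximum over the compact normalised set is restated as a Rayleigh-type bound by
  homogeneity, so that later perturbations may leave the normalisation
  \<open>(\<Sum>i\<in>V. y i ^ k) = 1\<close>.\<close>

lemma lap_energy_maximiser:
  assumes G: "kgraph k V E" and k: "1 \<le> k" and V: "V \<noteq> {}"
  obtains x where "\<And>i. i \<in> V \<Longrightarrow> 0 \<le> x i" "(\<Sum>i\<in>V. x i ^ k) = 1"
    "\<And>y. (\<And>i. i \<in> V \<Longrightarrow> 0 \<le> y i) \<Longrightarrow> lap_energy k V E y \<le> lap_energy k V E x * (\<Sum>i\<in>V. y i ^ k)"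
proof -
  define B where "B = {x :: 'a \<Rightarrow> real. (\<forall>i\<in>V. x i \<in> {0..1}) \<and> (\<forall>i. i \<notin> V \<longrightarrow> x i = 0)}"
  define S where "S = B \<inter> {x. (\<Sum>i\<in>V. x i ^ k) = 1}"
  have fin: "finite V" using G by (simp add: kgraph_def)
  have coord: "continuous_on A (\<lambda>x. x i)" for i :: 'a and A :: "('a \<Rightarrow> real) set"
    by (rule continuous_on_subset[OF continuous_on_product_coordinates]) simp
  have "closed {x :: 'a \<Rightarrow> real. (\<Sum>i\<in>V. x i ^ k) = 1}"
    by (intro closed_Collect_eq continuous_on_sum continuous_on_power coord continuous_on_const)
  then have comp: "compact S"
    unfolding S_def B_def by (intro compact_Int_closed compact_unit_box)
  obtain v where v: "v \<in> V" using V by auto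
  have "(\<Sum>i\<in>V. (if i = v then 1 else 0 :: real) ^ k) = (\<Sum>i\<in>V. if i = v then 1 else 0)"
    using k by (intro sum.cong) auto
  then have "(\<lambda>i. if i = v then 1 else 0) \<in> S" using v fin by (auto simp: S_def B_def)
  then have ne: "S \<noteq> {}" by blast
  have "continuous_on S (lap_energy k V E)"
    unfolding lap_energy_def
    by (intro continuous_intros coord)
  then obtain x where x: "x \<in> S" "\<And>y. y \<in> S \<Longrightarrow> lap_energy k V E y \<le> lap_energy k V E x"
    using continuous_attains_sup[OF comp ne] by blast
  have "lap_energy k V E y \<le> lap_energy k V E x * (\<Sum>i\<in>V. y i ^ k)"
    if y: "\<And>i. i \<in> V \<Longrightarrow> 0 \<le> y i" for y
  proof -
    define g where "g = (\<Sum>i\<in>V. y i ^ k)"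
    have "0 \<le> g" unfolding g_def using y by (intro sum_nonneg) auto
    then consider "g = 0" | "0 < g" by fastforce
    then show ?thesis
    proof cases
      \<comment> \<open>A vector of zero norm vanishes on \<open>V\<close>, so it is treated as the
        scaling of \<open>y\<close> by \<open>0\<close>.\<close>
      case 1
      then have "\<forall>i\<in>V. y i ^ k = 0"
        unfolding g_def using y by (subst (asm) sum_nonneg_eq_0_iff[OF fin]) auto
      then have "lap_energy k V E y = lap_energy k V E (\<lambda>i. 0 * y i)"
        by (intro lap_energy_cong[OF G]) auto
      also have "\<dots> = 0" using lap_energy_scale[OF G, of 0 y] k by simp
      finally show ?thesis using 1 by (simp add: g_def)
    next
      case 2
      define c where "c = root k (1 / g)"
      have c: "0 \<le> c" "c ^ k = 1 / g" using 2 k by (auto simp: c_def)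
      define z where "z i = (if i \<in> V then c * y i else 0)" for i
      have z: "(\<Sum>i\<in>V. z i ^ k) = 1"
        using c 2 by (simp add: z_def power_mult_distrib sum_divide_distrib[symmetric] g_def)
      have z0: "0 \<le> z i" for i using y c by (simp add: z_def)
      \<comment> \<open>A single \<open>k\<close>-th power is at most the total \<open>1\<close>;
        this places the normalised vector in the box.\<close>
      have "z i \<le> 1" if "i \<in> V" for i
      proof -
        have "z i ^ k \<le> (\<Sum>i\<in>V. z i ^ k)" using that fin z0 by (intro member_le_sum) auto
        then have "z i ^ k \<le> 1 ^ k" using z by simp
        then show ?thesis using power_le_imp_le_base[of "z i" "k - 1" 1] k by simp
      qed
      moreover have "z i = 0" if "i \<notin> V" for i using that by (simp add: z_def)
      ultimately have "z \<in> S" using z z0 by (simp add: S_def B_def)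
      then have "lap_energy k V E z \<le> lap_energy k V E x" by (rule x)
      moreover have "lap_energy k V E z = lap_energy k V E y / g"
        using lap_energy_cong[OF G, of z "\<lambda>i. c * y i"] lap_energy_scale[OF G, of c y] c
        by (simp add: z_def)
      ultimately show ?thesis using 2 by (simp add: g_def[symmetric] field_simps)
    qed
  qed
  with x(1) show thesis by (intro that[of x]) (simp_all add: S_def B_def)
qed

text \<open>
  If the edge \<open>e\<close> meets both the support and its complement, then raising the zero
  entries on \<open>e\<close> to \<open>t\<close> gains a multiple of \<open>t ^ m\<close> with \<open>m < k\<close>, at a cost of order \<open>t ^ k\<close>.
\<close>

lemma maximiser_support_closed:
  assumes G: "kgraph k V E" and k: "1 \<le> k"
    and x0: "\<And>i. i \<in> V \<Longrightarrow> 0 \<le> x i" and x1: "(\<Sum>i\<in>V. x i ^ k) = 1"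
    and max: "\<And>y. (\<And>i. i \<in> V \<Longrightarrow> 0 \<le> y i) \<Longrightarrow> lap_energy k V E y \<le> lap_energy k V E x * (\<Sum>i\<in>V. y i ^ k)"
    and e: "e \<in> E" "u \<in> e" "0 < x u" and w: "w \<in> e"
  shows "0 < x w"
proof (rule ccontr)
  assume nw: "\<not> 0 < x w"
  define Z where "Z = {i\<in>e. x i = 0}"
  define m where "m = card Z"
  define c where "c = (\<Prod>i\<in>e - Z. x i)"
  define M where "M = lap_energy k V E x"
  have fin: "finite V" and eV: "\<And>f. f \<in> E \<Longrightarrow> f \<subseteq> V" and ek: "card e = k"
    using G e by (auto simp: kgraph_def)
  have fE: "finite E" using G by (rule kgraph_finite_edges)
  have fe: "finite e" using eV[OF e(1)] fin finite_subset by blast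
  have "u \<notin> Z" using e by (simp add: Z_def)
  moreover have "Z \<subseteq> e" by (auto simp: Z_def)
  ultimately have Z: "Z \<subseteq> e" "Z \<subset> e" using e by blast+
  have ZV: "Z \<subseteq> V" "finite Z" using Z eV[OF e(1)] fe finite_subset by blast+
  have mk: "m < k" unfolding m_def ek[symmetric] using Z fe by (intro psubset_card_mono)
  have "w \<in> Z" using nw w x0 eV[OF e(1)] by (force simp: Z_def)
  have c0: "0 < c" unfolding c_def
    using x0 eV[OF e(1)] by (intro prod_pos) (force simp: Z_def)
  have Mn: "0 \<le> M" unfolding M_def lap_energy_def
    using x0 eV by (intro add_nonneg_nonneg sum_nonneg mult_nonneg_nonneg prod_nonneg) auto
  \<comment> \<open>The gain \<open>k * c * t ^ m\<close> is weighed against the cost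
    \<open>M * m * t ^ k\<close>. Cancelling \<open>t ^ m\<close> leaves \<open>t ^ (k - m)\<close>,
    which is at most \<open>t\<close> because \<open>m < k\<close> and
    \<open>t \<le> 1\<close>.\<close>
  have key: "real k * c \<le> M * real m * t" if t: "0 < t" "t \<le> 1" for t
  proof -
    define y where "y i = (if i \<in> Z then t else x i)" for i
    have y0: "0 \<le> y i" if "i \<in> V" for i using that x0 t by (simp add: y_def)
    have yx: "x i \<le> y i" for i using t by (simp add: y_def Z_def)
    have "(\<Sum>i\<in>V. y i ^ k) = (\<Sum>i\<in>V. x i ^ k + (if i \<in> Z then t ^ k else 0))"
      using k by (intro sum.cong) (auto simp: y_def Z_def)
    also have "\<dots> = 1 + real m * t ^ k"
      using x1 fin ZV by (simp add: sum.distrib sum.If_cases m_def Int_absorb1)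
    finally have ysum: "(\<Sum>i\<in>V. y i ^ k) = 1 + real m * t ^ k" .
    have xe: "(\<Prod>j\<in>e. x j) = 0" using fe \<open>w \<in> Z\<close> by (auto simp: Z_def)
    have "(\<Prod>j\<in>e. y j) = (\<Prod>j\<in>e - Z. y j) * (\<Prod>j\<in>Z. y j)"
      using prod.subset_diff[OF Z(1) fe] .
    also have "(\<Prod>j\<in>Z. y j) = t ^ m" by (simp add: y_def m_def)
    also have "(\<Prod>j\<in>e - Z. y j) = c" unfolding c_def by (intro prod.cong) (auto simp: y_def)
    finally have ye: "(\<Prod>j\<in>e. y j) = c * t ^ m" .
    \<comment> \<open>The edge \<open>e\<close> contributed \<open>0\<close> before the change,
      since \<open>w\<close> lies in it, and contributes \<open>c * t ^ m\<close> afterwards; no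
      other edge loses.\<close>
    have "(\<Sum>f\<in>E. \<Prod>j\<in>f. x j) + c * t ^ m = (\<Sum>f\<in>E - {e}. \<Prod>j\<in>f. x j) + (\<Prod>j\<in>e. y j)"
      using fE e xe ye by (simp add: sum.remove)
    also have "\<dots> \<le> (\<Sum>f\<in>E - {e}. \<Prod>j\<in>f. y j) + (\<Prod>j\<in>e. y j)"
      using x0 yx eV by (intro add_right_mono sum_mono prod_mono) blast
    also have "\<dots> = (\<Sum>f\<in>E. \<Prod>j\<in>f. y j)" using fE e by (simp add: sum.remove)
    finally have "real k * ((\<Sum>f\<in>E. \<Prod>j\<in>f. x j) + c * t ^ m) \<le> real k * (\<Sum>f\<in>E. \<Prod>j\<in>f. y j)"
      by (rule mult_left_mono) simp
    moreover have "(\<Sum>i\<in>V. real (vertex_degree E i) * x i ^ k) \<le> (\<Sum>i\<in>V. real (vertex_degree E i) * y i ^ k)"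
      using x0 yx by (intro sum_mono mult_left_mono power_mono) auto
    ultimately have "M + real k * c * t ^ m \<le> lap_energy k V E y"
      unfolding M_def lap_energy_def by (simp add: algebra_simps)
    also have "\<dots> \<le> M * (1 + real m * t ^ k)"
      unfolding M_def ysum[symmetric] using y0 by (intro max)
    finally have "real k * c * t ^ m \<le> M * real m * t ^ k" by (simp add: algebra_simps)
    also have "t ^ k = t ^ (k - m) * t ^ m" using mk by (simp add: power_add[symmetric])
    finally have "real k * c * t ^ m \<le> (M * real m * t ^ (k - m)) * t ^ m" by (simp add: mult.assoc)
    then have "real k * c \<le> M * real m * t ^ (k - m)" using t by simp
    also have "\<dots> \<le> M * real m * t ^ 1"
      using t mk Mn by (intro mult_left_mono power_decreasing) auto
    finally show ?thesis by simp
  qed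
  \<comment> \<open>Chosen so that \<open>2 * t * (M * m + 1) \<le> k * c\<close>, which contradicts
    \<open>key\<close>. The summand \<open>1\<close> keeps the denominator positive when only
    \<open>0 \<le> M\<close> is known.\<close>
  define t where "t = min 1 (real k * c / (2 * (M * real m + 1)))"
  have kc: "0 < real k * c" using c0 k by simp
  have p: "0 < M * real m + 1" using Mn by (simp add: add_nonneg_pos)
  have t: "0 < t" "t \<le> 1" unfolding t_def using kc p by auto
  have "t \<le> real k * c / (2 * (M * real m + 1))" by (simp add: t_def)
  then have "t * (2 * (M * real m + 1)) \<le> real k * c" using p by (simp add: pos_le_divide_eq)
  moreover have "0 \<le> M * real m * t" using Mn t by simp
  ultimately show False using key[OF t] t kc by (simp add: algebra_simps)
qed

text \<open>Edgewise form of being a union of connectivity classes. Connectedness can then be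
  expressed as the absence of proper nonempty closed subsets, which is what a support argument
  uses.\<close>

definition kgraph_closed :: "'a set set \<Rightarrow> 'a set \<Rightarrow> bool" where
  "kgraph_closed E S \<longleftrightarrow> (\<forall>e\<in>E. e \<inter> S \<noteq> {} \<longrightarrow> e \<subseteq> S)"

text \<open>The support of the maximiser is nonempty and closed, hence all of \<open>V\<close>.
  Every coordinate is then interior to the half-line, and stationarity in each of them gives the
  eigenvalue equation with the maximum \<open>M\<close> as eigenvalue.\<close>

lemma connected_kgraph_Hpp_eigenvalue:
  assumes G: "kgraph k V E" and k: "1 \<le> k" and V: "V \<noteq> {}"
    and conn: "\<And>S. S \<subseteq> V \<Longrightarrow> S \<noteq> {} \<Longrightarrow> kgraph_closed E S \<Longrightarrow> S = V"
  shows "\<exists>l. Hpp_eigenvalue k V (signless_laplacian k E) l"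
proof -
  obtain x where x0: "\<And>i. i \<in> V \<Longrightarrow> 0 \<le> x i" and x1: "(\<Sum>i\<in>V. x i ^ k) = 1" and
    max: "\<And>y. (\<And>i. i \<in> V \<Longrightarrow> 0 \<le> y i) \<Longrightarrow> lap_energy k V E y \<le> lap_energy k V E x * (\<Sum>i\<in>V. y i ^ k)"
    by (rule lap_energy_maximiser[OF G k V]) blast
  define M where "M = lap_energy k V E x"
  have fin: "finite V" and edge: "\<And>e. e \<in> E \<Longrightarrow> e \<subseteq> V" using G by (auto simp: kgraph_def)
  have fE: "finite E" using G by (rule kgraph_finite_edges)
  have "{i\<in>V. 0 < x i} = V"
  proof (rule conn)
    show "{i\<in>V. 0 < x i} \<noteq> {}"
    proof
      assume "{i\<in>V. 0 < x i} = {}"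
      then have "\<And>i. i \<in> V \<Longrightarrow> x i = 0" using x0 by force
      then have "(\<Sum>i\<in>V. x i ^ k) = 0" using k by (intro sum.neutral) auto
      with x1 show False by simp
    qed
    show "kgraph_closed E {i\<in>V. 0 < x i}"
      unfolding kgraph_closed_def
    proof (intro ballI impI subsetI)
      fix e w assume e: "e \<in> E" "e \<inter> {i\<in>V. 0 < x i} \<noteq> {}" "w \<in> e"
      then obtain u where "u \<in> e" "0 < x u" by auto
      then have "0 < x w" using maximiser_support_closed[OF G k x0 x1 max e(1) _ _ e(3)] by blast
      with e edge show "w \<in> {i\<in>V. 0 < x i}" by blast
    qed
  qed auto
  then have pos: "\<And>i. i \<in> V \<Longrightarrow> 0 < x i" by blast
  have "lap_form k E x i = M * x i ^ (k - 1)" if i: "i \<in> V" for i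
  proof -
    \<comment> \<open>Only the coordinate \<open>i\<close> will vary. Edges through \<open>i\<close>
      have that factor taken out in \<open>a\<close>; the terms free of it are collected in
      \<open>b\<close>, \<open>d\<close> and \<open>g\<close>.\<close>
    define a where "a = (\<Sum>e | e \<in> E \<and> i \<in> e. \<Prod>j\<in>e - {i}. x j)"
    define b where "b = (\<Sum>e | e \<in> E \<and> i \<notin> e. \<Prod>j\<in>e. x j)"
    define d where "d = (\<Sum>j\<in>V - {i}. real (vertex_degree E j) * x j ^ k)"
    define g where "g = (\<Sum>j\<in>V - {i}. x j ^ k)"
    \<comment> \<open>Energy minus \<open>M\<close> times the \<open>k\<close>-th power sum, as a
      function of the \<open>i\<close>-th coordinate. \<open>M\<close> acts as Lagrange multiplier:
      \<open>h\<close> is nonpositive for admissible \<open>t\<close> and zero at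
      \<open>x i\<close>, an unconstrained maximum.\<close>
    define h where "h t = (real (vertex_degree E i) * t ^ k + d + real k * (t * a + b)) - M * (t ^ k + g)" for t
    have h: "h t = lap_energy k V E (x(i := t)) - M * (\<Sum>j\<in>V. (x(i := t)) j ^ k)" for t
    proof -
      let ?y = "x(i := t)"
      have 1: "(\<Sum>j\<in>V. ?y j ^ k) = t ^ k + g"
        using fin i by (simp add: sum.remove g_def)
      have 2: "(\<Sum>j\<in>V. real (vertex_degree E j) * ?y j ^ k) = real (vertex_degree E i) * t ^ k + d"
        using fin i by (simp add: sum.remove d_def)
      have "(\<Sum>e\<in>E. \<Prod>j\<in>e. ?y j) = (\<Sum>e\<in>E \<inter> {e. i \<in> e}. \<Prod>j\<in>e. ?y j) + (\<Sum>e\<in>E - {e. i \<in> e}. \<Prod>j\<in>e. ?y j)"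
        using fE by (rule sum.Int_Diff)
      also have "(\<Sum>e\<in>E \<inter> {e. i \<in> e}. \<Prod>j\<in>e. ?y j) = t * a"
        unfolding a_def sum_distrib_left
      proof (rule sum.cong)
        fix e assume e: "e \<in> {e. e \<in> E \<and> i \<in> e}"
        then have fe: "finite e" using edge fin finite_subset by blast
        have "(\<Prod>j\<in>e. ?y j) = ?y i * (\<Prod>j\<in>e - {i}. ?y j)"
          using e fe by (intro prod.remove) auto
        also have "(\<Prod>j\<in>e - {i}. ?y j) = (\<Prod>j\<in>e - {i}. x j)" by (intro prod.cong) auto
        also have "?y i = t" by simp
        finally show "(\<Prod>j\<in>e. ?y j) = t * (\<Prod>j\<in>e - {i}. x j)" .
      qed auto
      also have "(\<Sum>e\<in>E - {e. i \<in> e}. \<Prod>j\<in>e. ?y j) = b"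
        unfolding b_def by (intro sum.cong prod.cong) auto
      finally show ?thesis unfolding h_def lap_energy_def 1 2 by simp
    qed
    \<comment> \<open>The radius \<open>x i\<close> forces \<open>0 < t\<close>, so the perturbed
      vector stays nonnegative; it is a valid radius because \<open>x i\<close> is positive.\<close>
    have "h t \<le> h (x i)" if "\<bar>x i - t\<bar> < x i" for t
    proof -
      have "0 \<le> (x(i := t)) j" if "j \<in> V" for j
        using x0[OF that] \<open>\<bar>x i - t\<bar> < x i\<close> by auto
      then have "h t \<le> 0" unfolding h M_def using max[of "x(i := t)"] by (simp only: diff_le_0_iff_le)
      moreover have "h (x i) = 0" unfolding h by (simp add: M_def x1)
      ultimately show ?thesis by simp
    qed
    moreover have "DERIV h (x i) :> real k * (real (vertex_degree E i) * x i ^ (k - 1) + a) - M * (real k * x i ^ (k - 1))"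
      unfolding h_def by (auto intro!: derivative_eq_intros simp: algebra_simps)
    ultimately have "real k * (real (vertex_degree E i) * x i ^ (k - 1) + a) - M * (real k * x i ^ (k - 1)) = 0"
      using DERIV_local_max pos[OF i] by blast
    then have "real k * (real (vertex_degree E i) * x i ^ (k - 1) + a) = real k * (M * x i ^ (k - 1))"
      by (simp add: algebra_simps)
    then show ?thesis using k by (simp add: lap_form_def a_def)
  qed
  then have "H_eigenpair k V (signless_laplacian k E) M x"
    using V pos by (force simp: H_eigenpair_signless_laplacian_iff[OF G k])
  with pos show ?thesis by (auto simp: Hpp_eigenvalue_def)
qed

section \<open>Components as closed, connected sub-\<open>k\<close>-graphs\<close>

lemma equiv_kgraph_connected_rel: "equiv V (kgraph_connected_rel V E)"
proof (rule equivI)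
  have "symp (kgraph_adjacent E)" by (auto simp: symp_def kgraph_adjacent_def)
  then have "symp (kgraph_adjacent E)\<^sup>*\<^sup>*" by (rule symp_rtranclp)
  then show "sym (kgraph_connected_rel V E)"
    by (auto simp: sym_def symp_def kgraph_connected_rel_def)
  show "trans (kgraph_connected_rel V E)"
    by (auto simp: trans_def kgraph_connected_rel_def)
qed (auto simp: refl_on_def kgraph_connected_rel_def)

lemma component_subset: "W \<in> V // kgraph_connected_rel V E \<Longrightarrow> W \<subseteq> V"
  by (auto simp: quotient_def kgraph_connected_rel_def)

lemma component_nonempty: "W \<in> V // kgraph_connected_rel V E \<Longrightarrow> W \<noteq> {}"
  using equiv_kgraph_connected_rel by (metis in_quotient_imp_non_empty)

lemma component_closed:
  assumes G: "kgraph k V E" and W: "W \<in> V // kgraph_connected_rel V E"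
  shows "kgraph_closed E W"
  unfolding kgraph_closed_def
proof (intro ballI impI subsetI)
  fix e w assume e: "e \<in> E" "e \<inter> W \<noteq> {}" "w \<in> e"
  then obtain u where u: "u \<in> e" "u \<in> W" by auto
  have "e \<subseteq> V" using G e by (auto simp: kgraph_def)
  moreover have "kgraph_adjacent E u w" using e u by (auto simp: kgraph_adjacent_def)
  ultimately have "(u, w) \<in> kgraph_connected_rel V E"
    using u e by (auto simp: kgraph_connected_rel_def)
  then show "w \<in> W"
    by (rule in_quotient_imp_closed[OF equiv_kgraph_connected_rel W u(2)])
qed

text \<open>Provides the connectedness hypothesis of the existence result: starting in
  \<open>S\<close>, a path to any vertex of \<open>W\<close> never leaves \<open>S\<close>.\<close>

lemma component_connected:
  assumes G: "kgraph k V E" and W: "W \<in> V // kgraph_connected_rel V E"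
    and S: "S \<subseteq> W" "S \<noteq> {}" "kgraph_closed {e \<in> E. e \<subseteq> W} S"
  shows "S = W"
proof
  obtain u where u: "u \<in> S" using S by auto
  show "W \<subseteq> S"
  proof
    fix w assume "w \<in> W"
    then have "(u, w) \<in> kgraph_connected_rel V E"
      using u S(1) quotient_eq_iff[OF equiv_kgraph_connected_rel W W, of u w] by auto
    then have "(kgraph_adjacent E)\<^sup>*\<^sup>* u w" by (simp add: kgraph_connected_rel_def)
    then show "w \<in> S"
    proof induction
      case base
      show ?case by (rule u)
    next
      case (step y z)
      then obtain e where e: "e \<in> E" "y \<in> e" "z \<in> e" by (auto simp: kgraph_adjacent_def)
      \<comment> \<open>Closedness of \<open>S\<close> speaks only of edges inside \<open>W\<close>,
        so the edge is first placed there by closedness of \<open>W\<close>.\<close>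
      then have "e \<subseteq> W" using step.IH S(1) component_closed[OF G W] by (auto simp: kgraph_closed_def)
      then show ?case using e step.IH S(3) by (auto simp: kgraph_closed_def)
    qed
  qed
qed (rule S)

lemma kgraph_restrict:
  assumes "kgraph k V E" "W \<subseteq> V" "kgraph_closed E W"
  shows "kgraph k W {e \<in> E. e \<subseteq> W}"
proof -
  have "\<exists>e\<in>{e \<in> E. e \<subseteq> W}. v \<in> e" if v: "v \<in> W" for v
  proof -
    obtain e where e: "e \<in> E" "v \<in> e" using assms v unfolding kgraph_def by blast
    then have "e \<subseteq> W" using assms(3) v by (auto simp: kgraph_closed_def)
    with e show ?thesis by blast
  qed
  then show ?thesis using assms by (auto simp: kgraph_def intro: finite_subset)
qed

section \<open>Passing eigenvectors between a \<open>k\<close>-graph and its components\<close>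

text \<open>All edges through a vertex of \<open>W\<close> lie in \<open>W\<close>, so neither the
  degree nor the edge sum there changes. Allowing two vectors that agree on \<open>W\<close> covers
  restriction, gluing and extension by zero.\<close>

lemma lap_form_restrict:
  assumes "kgraph_closed E W" "i \<in> W" "\<And>j. j \<in> W \<Longrightarrow> x j = y j"
  shows "lap_form k {e \<in> E. e \<subseteq> W} x i = lap_form k E y i"
proof -
  have eq: "{e \<in> {e \<in> E. e \<subseteq> W}. i \<in> e} = {e \<in> E. i \<in> e}"
    using assms by (auto simp: kgraph_closed_def)
  have "e \<subseteq> W" if "e \<in> E" "i \<in> e" for e using that assms by (auto simp: kgraph_closed_def)
  then have "(\<Sum>e | e \<in> E \<and> i \<in> e. \<Prod>j\<in>e - {i}. x j) = (\<Sum>e | e \<in> E \<and> i \<in> e. \<Prod>j\<in>e - {i}. y j)"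
    using assms by (intro sum.cong prod.cong) auto
  then show ?thesis
    unfolding lap_form_def vertex_degree_def eq using assms by simp
qed

lemma kgraph_component:
  assumes "kgraph k V E" "W \<in> V // kgraph_connected_rel V E"
  shows "kgraph k W {e \<in> E. e \<subseteq> W}"
  using kgraph_restrict[OF assms(1) component_subset[OF assms(2)] component_closed[OF assms]] .

lemma component_H_eigenpair_iff:
  assumes G: "kgraph k V E" and k: "1 \<le> k" and W: "W \<in> V // kgraph_connected_rel V E"
  shows "H_eigenpair k W (signless_laplacian k {e \<in> E. e \<subseteq> W}) l x \<longleftrightarrow>
    (\<exists>i\<in>W. x i \<noteq> 0) \<and> (\<forall>i\<in>W. lap_form k E x i = l * x i ^ (k - 1))"
proof -
  have "lap_form k {e \<in> E. e \<subseteq> W} x i = lap_form k E x i" if "i \<in> W" for i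
    using component_closed[OF G W] that by (rule lap_form_restrict) (rule refl)
  then show ?thesis
    by (simp add: H_eigenpair_signless_laplacian_iff[OF kgraph_component[OF G W] k])
qed

lemma Hpp_eigenvalue_component:
  assumes G: "kgraph k V E" and k: "1 \<le> k" and W: "W \<in> V // kgraph_connected_rel V E"
    and l: "Hpp_eigenvalue k V (signless_laplacian k E) l"
  shows "Hpp_eigenvalue k W (signless_laplacian k {e \<in> E. e \<subseteq> W}) l"
proof -
  obtain x where x: "H_eigenpair k V (signless_laplacian k E) l x" and pos: "\<And>i. i \<in> V \<Longrightarrow> 0 < x i"
    using l by (auto simp: Hpp_eigenvalue_def)
  have "\<exists>w\<in>W. x w \<noteq> 0"
    using component_nonempty[OF W] component_subset[OF W] pos by (metis all_not_in_conv less_irrefl subsetD)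
  moreover have "\<forall>i\<in>W. lap_form k E x i = l * x i ^ (k - 1)"
    using x component_subset[OF W] by (auto simp: H_eigenpair_signless_laplacian_iff[OF G k])
  ultimately have "H_eigenpair k W (signless_laplacian k {e \<in> E. e \<subseteq> W}) l x"
    by (simp add: component_H_eigenpair_iff[OF G k W])
  then show ?thesis using pos component_subset[OF W] by (auto simp: Hpp_eigenvalue_def)
qed

text \<open>The equation at a vertex involves only values on its own class, so the positive
  eigenvectors may be chosen independently on the classes as long as \<open>l\<close> is
  common.\<close>

lemma Hpp_eigenvalue_glue:
  assumes G: "kgraph k V E" and k: "1 \<le> k" and V: "V \<noteq> {}"
    and l: "\<And>W. W \<in> V // kgraph_connected_rel V E \<Longrightarrow>
      Hpp_eigenvalue k W (signless_laplacian k {e \<in> E. e \<subseteq> W}) l"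
  shows "Hpp_eigenvalue k V (signless_laplacian k E) l"
proof -
  let ?R = "kgraph_connected_rel V E"
  obtain X where X: "\<And>W. W \<in> V // ?R \<Longrightarrow> H_eigenpair k W (signless_laplacian k {e \<in> E. e \<subseteq> W}) l (X W)"
      and pos: "\<And>W i. W \<in> V // ?R \<Longrightarrow> i \<in> W \<Longrightarrow> 0 < X W i"
    using l unfolding Hpp_eigenvalue_def by metis
  define x where "x i = X (?R `` {i}) i" for i
  have cls: "?R `` {i} \<in> V // ?R" "i \<in> ?R `` {i}" if "i \<in> V" for i
    using that equiv_class_self[OF equiv_kgraph_connected_rel] by (auto intro: quotientI)
  have xpos: "0 < x i" if "i \<in> V" for i
    unfolding x_def using pos cls[OF that] by blast
  moreover have "lap_form k E x i = l * x i ^ (k - 1)" if i: "i \<in> V" for i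
  proof -
    let ?W = "?R `` {i}"
    have "X ?W j = x j" if "j \<in> ?W" for j
      using that equiv_class_eq[OF equiv_kgraph_connected_rel, of i j V E] by (simp add: x_def)
    then have "lap_form k {e \<in> E. e \<subseteq> ?W} (X ?W) i = lap_form k E x i"
      by (rule lap_form_restrict[OF component_closed[OF G cls(1)[OF i]] cls(2)[OF i]])
    moreover have "lap_form k {e \<in> E. e \<subseteq> ?W} (X ?W) i = l * X ?W i ^ (k - 1)"
      using X[OF cls(1)[OF i]] cls[OF i] kgraph_component[OF G cls(1)[OF i]] k
      by (simp add: H_eigenpair_signless_laplacian_iff)
    ultimately show ?thesis by (simp add: x_def)
  qed
  moreover have "\<exists>i\<in>V. x i \<noteq> 0" using V xpos by (metis all_not_in_conv less_irrefl)
  ultimately have "H_eigenpair k V (signless_laplacian k E) l x"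
    by (simp add: H_eigenpair_signless_laplacian_iff[OF G k])
  with xpos show ?thesis by (auto simp: Hpp_eigenvalue_def)
qed

lemma lap_form_eq_0:
  assumes "kgraph k V E" "2 \<le> k" "x i = 0" "\<And>e. e \<in> E \<Longrightarrow> i \<in> e \<Longrightarrow> \<exists>j\<in>e - {i}. x j = 0"
  shows "lap_form k E x i = 0"
proof -
  have "(\<Prod>j\<in>e - {i}. x j) = 0" if "e \<in> E" "i \<in> e" for e
  proof -
    have "finite e" using that assms(1) by (auto simp: kgraph_def intro: finite_subset)
    then show ?thesis using assms(4)[OF that] by (intro prod_zero) auto
  qed
  then show ?thesis using assms(2,3) by (simp add: lap_form_def zero_power)
qed

text \<open>After extension by zero, an edge through a vertex outside \<open>W\<close> misses
  \<open>W\<close> altogether, so both sides of the equation vanish there.\<close>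

lemma Hp_eigenvalue_extend:
  assumes G: "kgraph k V E" and k: "2 \<le> k" and W: "W \<in> V // kgraph_connected_rel V E"
    and l: "Hp_eigenvalue k W (signless_laplacian k {e \<in> E. e \<subseteq> W}) l"
  shows "Hp_eigenvalue k V (signless_laplacian k E) l"
proof -
  have k1: "1 \<le> k" using k by simp
  obtain x where x: "H_eigenpair k W (signless_laplacian k {e \<in> E. e \<subseteq> W}) l x"
      and nn: "\<And>i. i \<in> W \<Longrightarrow> 0 \<le> x i"
    using l by (auto simp: Hp_eigenvalue_def)
  define y where "y i = (if i \<in> W then x i else 0)" for i
  note cl = component_closed[OF G W]
  have "lap_form k E y i = l * y i ^ (k - 1)" if i: "i \<in> V" for i
  proof (cases "i \<in> W")
    case True
    have "lap_form k {e \<in> E. e \<subseteq> W} x i = lap_form k E y i"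
      using cl True by (rule lap_form_restrict) (simp add: y_def)
    then show ?thesis
      using x True by (simp add: H_eigenpair_signless_laplacian_iff[OF kgraph_component[OF G W] k1] y_def)
  next
    case False
    have "lap_form k E y i = 0"
    proof (rule lap_form_eq_0[OF G k])
      fix e assume e: "e \<in> E" "i \<in> e"
      then have "e \<inter> W = {}" using cl False by (auto simp: kgraph_closed_def)
      \<comment> \<open>As \<open>k \<ge> 2\<close>, the edge has a vertex besides \<open>i\<close>;
        without it the product over \<open>e - {i}\<close> would be empty and equal to
        \<open>1\<close>.\<close>
      moreover have "\<not> e \<subseteq> {i}"
      proof
        assume "e \<subseteq> {i}"
        then have "card e \<le> card {i}" by (intro card_mono) auto
        then show False using G e k by (auto simp: kgraph_def)
      qed
      ultimately show "\<exists>j\<in>e - {i}. y j = 0" by (auto simp: y_def)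
    qed (simp add: y_def False)
    then show ?thesis using False k by (simp add: y_def)
  qed
  moreover have "\<exists>i\<in>V. y i \<noteq> 0"
    using x component_subset[OF W] by (auto simp: component_H_eigenpair_iff[OF G k1 W] y_def)
  ultimately have "H_eigenpair k V (signless_laplacian k E) l y"
    by (simp add: H_eigenpair_signless_laplacian_iff[OF G k1])
  then show ?thesis using nn by (auto simp: Hp_eigenvalue_def y_def)
qed

text \<open>The variational argument yields some positive eigenvector, and the comparison argument
  identifies its eigenvalue.\<close>

lemma component_Hpp_spectral_radius:
  assumes G: "kgraph k V E" and k: "1 \<le> k" and W: "W \<in> V // kgraph_connected_rel V E"
  shows "Hpp_eigenvalue k W (signless_laplacian k {e \<in> E. e \<subseteq> W})
    (tensor_spectral_radius k W (signless_laplacian k {e \<in> E. e \<subseteq> W}))"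
proof -
  note H = kgraph_component[OF G W] and ne = component_nonempty[OF W]
  obtain l where "Hpp_eigenvalue k W (signless_laplacian k {e \<in> E. e \<subseteq> W}) l"
    using connected_kgraph_Hpp_eigenvalue[OF H k ne] component_connected[OF G W] by blast
  then show ?thesis using Hpp_eigenvalue_eq_spectral_radius[OF H k ne] by simp
qed

section \<open>Vertex degrees as strict H+-eigenvalues\<close>

text \<open>For \<open>k \<ge> 3\<close> an edge through \<open>i\<close> has a vertex other than
  \<open>i\<close> and \<open>j\<close>, where the unit vector is zero. All edge products vanish and
  only the diagonal part remains.\<close>

lemma degree_H_eigenpair:
  assumes G: "kgraph k V E" and k: "3 \<le> k" and j: "j \<in> V"
  shows "H_eigenpair k V (signless_laplacian k E) (real (vertex_degree E j)) (std_unit_vector j)"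
proof -
  have k1: "1 \<le> k" using k by simp
  have "(\<Prod>u\<in>e - {i}. std_unit_vector j u) = 0" if e: "e \<in> E" "i \<in> e" for e i
  proof -
    have "finite e" "card e = k" using e G by (auto simp: kgraph_def intro: finite_subset)
    moreover have "\<not> e \<subseteq> {i, j}"
    proof
      assume "e \<subseteq> {i, j}"
      then have "card e \<le> card {i, j}" by (intro card_mono) auto
      also have "\<dots> \<le> 2" by (simp add: card_insert_if)
      finally show False using \<open>card e = k\<close> k by simp
    qed
    ultimately show ?thesis by (auto simp: std_unit_vector_def)
  qed
  then have "lap_form k E (std_unit_vector j) i = real (vertex_degree E i) * std_unit_vector j i ^ (k - 1)" for i
    by (simp add: lap_form_def)
  then show ?thesis
    using j k by (auto simp: H_eigenpair_signless_laplacian_iff[OF G k1] std_unit_vector_def)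
qed

text \<open>The equation at \<open>j\<close> would force the edge sum there to be zero, but it is
  positive for a positive vector because some edge contains \<open>j\<close>.\<close>

lemma degree_not_Hpp_eigenvalue:
  assumes G: "kgraph k V E" and k: "1 \<le> k" and j: "j \<in> V"
  shows "\<not> Hpp_eigenvalue k V (signless_laplacian k E) (real (vertex_degree E j))"
proof
  assume "Hpp_eigenvalue k V (signless_laplacian k E) (real (vertex_degree E j))"
  then obtain x where pos: "\<And>i. i \<in> V \<Longrightarrow> 0 < x i"
      and eq: "lap_form k E x j = real (vertex_degree E j) * x j ^ (k - 1)"
    using j by (auto simp: Hpp_eigenvalue_def H_eigenpair_signless_laplacian_iff[OF G k])
  have "0 < (\<Sum>e | e \<in> E \<and> j \<in> e. \<Prod>i\<in>e - {j}. x i)"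
  proof (rule sum_pos)
    show "finite {e. e \<in> E \<and> j \<in> e}" using kgraph_finite_edges[OF G] by simp
    show "{e. e \<in> E \<and> j \<in> e} \<noteq> {}" using G j by (auto simp: kgraph_def)
    show "0 < (\<Prod>i\<in>e - {j}. x i)" if "e \<in> {e. e \<in> E \<and> j \<in> e}" for e
      using that G by (intro prod_pos pos) (auto simp: kgraph_def)
  qed
  with eq show False by (simp add: lap_form_def)
qed

theorem theorem6:
  fixes k n s :: nat
    and E :: "nat set set"
    and Vc :: "nat \<Rightarrow> nat set"
    and Ec :: "nat \<Rightarrow> nat set set"
    and Q :: "nat tensor"
    and \<nu>\<^sub>1 :: real
  assumes "3 \<le> k"
    and "1 \<le> n"
    and "kgraph k {1..n} E"
    and "bij_betw (\<lambda>r. (Vc r, Ec r)) {1..s} (kgraph_components {1..n} E)"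
    and "Q = signless_laplacian k E"
    and "\<nu>\<^sub>1 = tensor_spectral_radius k {1..n} Q"
  shows "(\<forall>j\<in>{1..n}.
            strict_Hp_eigenvalue k {1..n} Q (real (vertex_degree E j)) \<and>
            H_eigenpair k {1..n} Q (real (vertex_degree E j)) (std_unit_vector j))
       \<and> ((\<forall>r\<in>{1..s}. \<nu>\<^sub>1 = tensor_spectral_radius k (Vc r) (signless_laplacian k (Ec r))) \<longrightarrow>
            Hpp_eigenvalue k {1..n} Q \<nu>\<^sub>1 \<and> (\<forall>\<mu>. Hpp_eigenvalue k {1..n} Q \<mu> \<longrightarrow> \<mu> = \<nu>\<^sub>1))
       \<and> (\<not> (\<forall>r\<in>{1..s}. \<nu>\<^sub>1 = tensor_spectral_radius k (Vc r) (signless_laplacian k (Ec r))) \<longrightarrow>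
            (\<nexists>\<mu>. Hpp_eigenvalue k {1..n} Q \<mu>) \<and>
            (\<forall>r\<in>{1..s}. strict_Hp_eigenvalue k {1..n} Q
                (tensor_spectral_radius k (Vc r) (signless_laplacian k (Ec r)))))"
proof (intro conjI ballI impI)
  let ?V = "{1..n}" and ?R = "kgraph_connected_rel {1..n} E"
  let ?Q = "\<lambda>W. signless_laplacian k {e \<in> E. e \<subseteq> W}"
  note G = assms(3) and Q = assms(5)
  have k: "1 \<le> k" "2 \<le> k" and V: "?V \<noteq> {}" using assms(1,2) by auto
  have img: "(\<lambda>r. (Vc r, Ec r)) ` {1..s} = kgraph_components ?V E"
    using assms(4) by (simp add: bij_betw_def)
  have comp: "Vc r \<in> ?V // ?R" "signless_laplacian k (Ec r) = ?Q (Vc r)" if "r \<in> {1..s}" for r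
  proof -
    have "(Vc r, Ec r) \<in> kgraph_components ?V E" using img that by blast
    then show "Vc r \<in> ?V // ?R" "signless_laplacian k (Ec r) = ?Q (Vc r)"
      by (auto simp: kgraph_components_def)
  qed
  \<comment> \<open>Gluing quantifies over all connectivity classes, so each must occur among the
    indexed components.\<close>
  have onto: "\<exists>r\<in>{1..s}. Vc r = W" if "W \<in> ?V // ?R" for W
  proof -
    have "(W, {e \<in> E. e \<subseteq> W}) \<in> (\<lambda>r. (Vc r, Ec r)) ` {1..s}"
      unfolding img kgraph_components_def using that by blast
    then show ?thesis by auto
  qed
  have \<nu>: "\<mu> = \<nu>\<^sub>1" if "Hpp_eigenvalue k ?V Q \<mu>" for \<mu>
    using Hpp_eigenvalue_eq_spectral_radius[OF G k(1) V] that by (simp add: assms(5,6))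
  {
    fix j assume j: "j \<in> ?V"
    show ev: "H_eigenpair k ?V Q (real (vertex_degree E j)) (std_unit_vector j)"
      unfolding Q by (rule degree_H_eigenpair[OF G assms(1) j])
    then have "Hp_eigenvalue k ?V Q (real (vertex_degree E j))"
      unfolding Hp_eigenvalue_def by (intro exI[of _ "std_unit_vector j"]) (simp add: std_unit_vector_def)
    then show "strict_Hp_eigenvalue k ?V Q (real (vertex_degree E j))"
      using degree_not_Hpp_eigenvalue[OF G k(1) j] by (simp add: strict_Hp_eigenvalue_def Q)
  }
  {
    assume eq: "\<forall>r\<in>{1..s}. \<nu>\<^sub>1 = tensor_spectral_radius k (Vc r) (signless_laplacian k (Ec r))"
    have "Hpp_eigenvalue k W (?Q W) \<nu>\<^sub>1" if W: "W \<in> ?V // ?R" for W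
    proof -
      obtain r where "r \<in> {1..s}" "Vc r = W" using onto[OF W] by blast
      then show ?thesis using component_Hpp_spectral_radius[OF G k(1) W] eq comp(2) by metis
    qed
    then show "Hpp_eigenvalue k ?V Q \<nu>\<^sub>1"
      unfolding Q by (rule Hpp_eigenvalue_glue[OF G k(1) V])
    show "\<forall>\<mu>. Hpp_eigenvalue k ?V Q \<mu> \<longrightarrow> \<mu> = \<nu>\<^sub>1" using \<nu> by blast
  }
  {
    assume neq: "\<not> (\<forall>r\<in>{1..s}. \<nu>\<^sub>1 = tensor_spectral_radius k (Vc r) (signless_laplacian k (Ec r)))"
    show none: "\<nexists>\<mu>. Hpp_eigenvalue k ?V Q \<mu>"
    proof
      assume "\<exists>\<mu>. Hpp_eigenvalue k ?V Q \<mu>"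
      then have hpp: "Hpp_eigenvalue k ?V (signless_laplacian k E) \<nu>\<^sub>1" using \<nu> Q by metis
      \<comment> \<open>A positive eigenvector of the whole restricts to each component with the
        same eigenvalue, which must be the spectral radius there; all radii would then
        agree.\<close>
      have "\<nu>\<^sub>1 = tensor_spectral_radius k (Vc r) (signless_laplacian k (Ec r))" if r: "r \<in> {1..s}" for r
        using Hpp_eigenvalue_eq_spectral_radius[OF kgraph_component[OF G comp(1)[OF r]] k(1)
            component_nonempty[OF comp(1)[OF r]] Hpp_eigenvalue_component[OF G k(1) comp(1)[OF r] hpp]]
        unfolding comp(2)[OF r] by simp
      with neq show False by blast
    qed
    fix r assume r: "r \<in> {1..s}"
    \<comment> \<open>The positive eigenvector of the component is extended by zero; strictness is
      automatic, since \<open>none\<close> excludes every H++-eigenvalue.\<close>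
    have "Hp_eigenvalue k (Vc r) (?Q (Vc r)) (tensor_spectral_radius k (Vc r) (?Q (Vc r)))"
      using component_Hpp_spectral_radius[OF G k(1) comp(1)[OF r]]
      unfolding Hpp_eigenvalue_def Hp_eigenvalue_def by (meson less_imp_le)
    then have "Hp_eigenvalue k ?V Q (tensor_spectral_radius k (Vc r) (signless_laplacian k (Ec r)))"
      unfolding comp(2)[OF r] Q by (rule Hp_eigenvalue_extend[OF G k(2) comp(1)[OF r]])
    with none show "strict_Hp_eigenvalue k ?V Q (tensor_spectral_radius k (Vc r) (signless_laplacian k (Ec r)))"
      by (simp add: strict_Hp_eigenvalue_def)
  }
qed

end
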